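(* Every finitely presented, unperforated partially ordered abelian group is Archimedean.
   Context: A partially ordered abelian group is an abelian group $G$ with a partial ordering $\leq$ such that $x\leq y$ implies $x+z\leq y+z$ for all $x,y,z\in G$. $G$ is finitely presented if there exists a finite generating subset $\{g_1,\ldots,g_n\}$ of the group $G$ such that $\{\langle x_1,\ldots,x_n\rangle\in\mathbb{Z}^n\mid g_1x_1+\cdots+g_nx_n\geq 0\}$ is a finitely generated submonoid of $\mathbb{Z}^n$. $G$ is unperforated if $mx\geq 0$ implies $x\geq 0$, for all positive integers $m$ and all $x\in G$. $G$ is Archimedean if, for all $a,b\in G$, if $na\leq b$ for all integers $n\geq 0$, then $a\leq 0$. *)

theory Defs
  imports
    "HOL.Hull"
    "HOL-Library.Function_Algebras"
    "HOL-Computational_Algebra.Group_Closure"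
begin

(* The canonical action of the integers on an abelian group (the library has none on
   ab_group_add). *)
definition int_scale :: "int \<Rightarrow> 'a::ab_group_add \<Rightarrow> 'a" where
  "int_scale k x = (if k \<ge> 0 then (\<Sum>i<nat k. x) else - (\<Sum>i<nat (- k). x))"

lemma int_scale_of_nat_diff:
  "int_scale (int m - int n) x = (\<Sum>i<m. x) - (\<Sum>i<n. x)"
proof -
  have add: "(\<Sum>i<p + q. x) = (\<Sum>i<p. x) + (\<Sum>i<q. x)" for p q :: nat
    by (induction q) (simp_all add: add.assoc)
  show ?thesis
  proof (cases "n \<le> m")
    case True
    then show ?thesis
      using add[of "m - n" n] by (simp add: int_scale_def nat_diff_distrib)
  next
    case False
    then show ?thesis
      using add[of "n - m" m] by (simp add: int_scale_def nat_diff_distrib)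
  qed
qed

lemma int_scale_0 [simp]: "int_scale 0 x = 0"
  by (simp add: int_scale_def)

lemma int_scale_1 [simp]: "int_scale 1 x = x"
  by (simp add: int_scale_def)

lemma int_scale_add_left: "int_scale (k + l) x = int_scale k x + int_scale l x"
proof -
  obtain a b c d where k: "k = int a - int b" and l: "l = int c - int d"
    by (metis int_diff_cases)
  have add: "(\<Sum>i<p + q. x) = (\<Sum>i<p. x) + (\<Sum>i<q. x)" for p q :: nat
    by (induction q) (simp_all add: add.assoc)
  have "k + l = int (a + c) - int (b + d)"
    using k l by simp
  then have "int_scale (k + l) x = (\<Sum>i<a + c. x) - (\<Sum>i<b + d. x)"
    by (simp only: int_scale_of_nat_diff)
  then show ?thesis
    by (simp only: k l int_scale_of_nat_diff add) (simp add: algebra_simps)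
qed

(* \<int>^n is rendered as the subgroup of the functions nat \<Rightarrow> int (with pointwise addition)
   that vanish from index n on, so that n may be quantified over. *)
definition int_vectors :: "nat \<Rightarrow> (nat \<Rightarrow> int) set" where
  "int_vectors n = {x. \<forall>i\<ge>n. x i = 0}"

definition is_submonoid :: "'a::comm_monoid_add set \<Rightarrow> bool" where
  "is_submonoid M \<longleftrightarrow> 0 \<in> M \<and> (\<forall>x\<in>M. \<forall>y\<in>M. x + y \<in> M)"

definition finitely_generated_submonoid :: "'a::comm_monoid_add set \<Rightarrow> bool" where
  "finitely_generated_submonoid M \<longleftrightarrow> (\<exists>B. finite B \<and> M = is_submonoid hull B)"

(* The generators are g 0, ..., g (n - 1); repetitions are allowed in this enumeration. *)
definition finitely_presented :: "'a::ordered_ab_group_add itself \<Rightarrow> bool" where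
  "finitely_presented _ \<longleftrightarrow>
    (\<exists>n (g :: nat \<Rightarrow> 'a).
      group_closure (g ` {..<n}) = UNIV \<and>
      finitely_generated_submonoid
        {x \<in> int_vectors n. (\<Sum>i<n. int_scale (x i) (g i)) \<ge> 0})"

definition unperforated :: "'a::ordered_ab_group_add itself \<Rightarrow> bool" where
  "unperforated _ \<longleftrightarrow> (\<forall>(m::int) (x::'a). m > 0 \<longrightarrow> int_scale m x \<ge> 0 \<longrightarrow> x \<ge> 0)"

definition archimedean_group :: "'a::ordered_ab_group_add itself \<Rightarrow> bool" where
  "archimedean_group _ \<longleftrightarrow>
    (\<forall>a b :: 'a. (\<forall>n::int. n \<ge> 0 \<longrightarrow> int_scale n a \<le> b) \<longrightarrow> a \<le> 0)"

end

theory Submission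
  imports Defs "HOL.Topological_Spaces"
begin

text \<open>The positive cone \<open>P\<close> of \<open>\<int>\<^sup>n\<close> is a finitely generated submonoid, so by Dickson's lemma any
  sequence in \<open>P\<close> has two entries \<open>x\<^sub>p\<close>, \<open>x\<^sub>q\<close>, \<open>p < q\<close>, with \<open>x\<^sub>q - x\<^sub>p \<in> P\<close>. If \<open>na \<le> b\<close> for all \<open>n\<close>,
  applying this to preimages of the elements \<open>b - na\<close> gives \<open>-(q - p)a \<ge> 0\<close>, whence \<open>a \<le> 0\<close> as
  the group is unperforated.\<close>

lemma is_submonoid_hull: "is_submonoid (is_submonoid hull B)"
  by (rule hull_in) (auto simp: is_submonoid_def)

lemma zero_in_hull: "0 \<in> is_submonoid hull B"
  and add_in_hull: "x \<in> is_submonoid hull B \<Longrightarrow> y \<in> is_submonoid hull B \<Longrightarrow> x + y \<in> is_submonoid hull B"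
  using is_submonoid_hull[of B] by (auto simp: is_submonoid_def)

lemma sum_const_in_hull: "p \<in> is_submonoid hull B \<Longrightarrow> (\<Sum>i<k::nat. p) \<in> is_submonoid hull B"
  by (induction k) (auto intro: zero_in_hull add_in_hull)

lemma sum_const_add: "(\<Sum>i<k + l. p) = (\<Sum>i<k. p) + (\<Sum>i<l. p)" for k l :: nat
  by (induction l) (simp_all add: add.assoc)

text \<open>Splits off one generator for the induction on \<open>B\<close>. The sums of a multiple
  of \<open>p\<close> and an element of the smaller hull form a submonoid containing
  \<open>insert p B\<close>, so minimality of the hull applies.\<close>

lemma submonoid_hull_insertE:
  assumes "x \<in> is_submonoid hull insert p B"
  obtains k :: nat and y where "y \<in> is_submonoid hull B" "x = (\<Sum>i<k. p) + y"
proof -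
  let ?M = "{(\<Sum>i<k. p) + y | (k::nat) y. y \<in> is_submonoid hull B}"
  have "insert p B \<subseteq> ?M"
  proof
    fix z assume z: "z \<in> insert p B"
    then consider "z = p" | "z \<in> is_submonoid hull B"
      using hull_inc by fast
    then show "z \<in> ?M"
    proof cases
      case 1
      then have "z = (\<Sum>i<Suc 0. p) + 0" by simp
      then show ?thesis using zero_in_hull by blast
    next
      case 2
      then have "z = (\<Sum>i<0::nat. p) + z" by simp
      then show ?thesis using 2 by blast
    qed
  qed
  moreover have "is_submonoid ?M"
  proof (rule is_submonoid_def [THEN iffD2], intro conjI ballI)
    have "0 = (\<Sum>i<0::nat. p) + 0" by simp
    then show "0 \<in> ?M" using zero_in_hull by blast
  next
    fix u v assume "u \<in> ?M" "v \<in> ?M"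
    then obtain k l :: nat and y z where
      "y \<in> is_submonoid hull B" "z \<in> is_submonoid hull B"
      "u = (\<Sum>i<k. p) + y" "v = (\<Sum>i<l. p) + z" by blast
    then have "u + v = (\<Sum>i<k + l. p) + (y + z)" "y + z \<in> is_submonoid hull B"
      by (simp_all only: sum_const_add ac_simps add_in_hull)
    then show "u + v \<in> ?M" by blast
  qed
  ultimately have "is_submonoid hull insert p B \<subseteq> ?M"
    by (rule hull_minimal)
  then show thesis using assms that by blast
qed

text \<open>Some subsequence is monotone in one direction. If it is nonincreasing, it is constant
  from an index of its minimum on, so dropping the terms before that index makes it
  nondecreasing.\<close>

lemma nat_seq_mono_subseq:
  fixes f :: "nat \<Rightarrow> nat"
  obtains r :: "nat \<Rightarrow> nat" where "strict_mono r" "mono (f \<circ> r)"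
proof -
  obtain r :: "nat \<Rightarrow> nat" where r: "strict_mono r" "monoseq (\<lambda>n. f (r n))"
    using seq_monosub[of f] by blast
  from r(2) consider "mono (f \<circ> r)" | "\<And>m n. m \<le> n \<Longrightarrow> f (r n) \<le> f (r m)"
    by (auto simp: monoseq_def mono_def)
  then show thesis
  proof cases
    case 1
    with r(1) that show ?thesis by blast
  next
    case 2
    obtain N where N: "\<And>n. f (r N) \<le> f (r n)"
      using ex_has_least_nat[of "\<lambda>_. True" 0 "\<lambda>n. f (r n)"] by auto
    have "f (r (n + N)) = f (r N)" for n
      using 2[of N "n + N"] N by (simp add: order_antisym)
    then have "mono (f \<circ> (\<lambda>n. r (n + N)))"
      by (simp add: mono_def)
    moreover have "strict_mono (\<lambda>n. r (n + N))"
      using r(1) by (simp add: strict_mono_def)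
    ultimately show ?thesis using that by blast
  qed
qed

text \<open>Dickson's lemma, with differences in the submonoid in place of comparing coefficient vectors.\<close>

lemma submonoid_hull_dickson:
  fixes x :: "nat \<Rightarrow> 'a::ab_group_add"
  assumes "finite B" and "\<And>n. x n \<in> is_submonoid hull B"
  shows "\<exists>r :: nat \<Rightarrow> nat. strict_mono r \<and> (\<forall>m n. m \<le> n \<longrightarrow> x (r n) - x (r m) \<in> is_submonoid hull B)"
  using assms
proof (induction B arbitrary: x rule: finite_induct)
  case empty
  have "is_submonoid hull {} \<subseteq> {0::'a}"
    by (rule hull_minimal) (auto simp: is_submonoid_def)
  with empty have "x n = 0" for n by blast
  then show ?case
    by (intro exI[of _ "id :: nat \<Rightarrow> nat"]) (simp add: strict_mono_def zero_in_hull)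
next
  case (insert p B)
  have "\<forall>n. \<exists>k y. y \<in> is_submonoid hull B \<and> x n = (\<Sum>i<k::nat. p) + y"
    by (blast intro: submonoid_hull_insertE[OF insert.prems])
  then obtain k :: "nat \<Rightarrow> nat" and y where y: "\<And>n. y n \<in> is_submonoid hull B"
    and x: "\<And>n. x n = (\<Sum>i<k n. p) + y n"
    unfolding choice_iff by blast
  \<comment> \<open>The induction hypothesis covers all pairs of indices of the subsequence, not
    just one, so \<open>r\<close> may be thinned out further by \<open>s\<close> to make the
    coefficients of \<open>p\<close> nondecreasing as well.\<close>
  obtain r :: "nat \<Rightarrow> nat" where r: "strict_mono r"
    and yr: "\<And>m n. m \<le> n \<Longrightarrow> y (r n) - y (r m) \<in> is_submonoid hull B"
    using insert.IH[of y, OF y] by blast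
  obtain s :: "nat \<Rightarrow> nat" where s: "strict_mono s" and ks: "mono ((k \<circ> r) \<circ> s)"
    using nat_seq_mono_subseq[of "k \<circ> r"] by blast
  have "x (r (s n)) - x (r (s m)) \<in> is_submonoid hull insert p B" if "m \<le> n" for m n
  proof -
    have "k (r (s m)) \<le> k (r (s n))"
      using ks that by (auto simp: mono_def)
    \<comment> \<open>A submonoid need not contain \<open>- p\<close>, so the multiple of
      \<open>p\<close> left in the difference must have a natural number \<open>d\<close> as its
      coefficient.\<close>
    then obtain d where "k (r (s n)) = k (r (s m)) + d"
      using le_iff_add by blast
    then have "x (r (s n)) - x (r (s m)) = (\<Sum>i<d. p) + (y (r (s n)) - y (r (s m)))"
      by (simp only: x sum_const_add) (simp add: algebra_simps)
    moreover have "y (r (s n)) - y (r (s m)) \<in> is_submonoid hull insert p B"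
      using yr[of "s m" "s n"] s that hull_mono[of B "insert p B" is_submonoid]
      by (auto simp: strict_mono_less_eq)
    moreover have "p \<in> is_submonoid hull insert p B"
      by (rule hull_inc) simp
    ultimately show ?thesis
      by (simp only: add_in_hull sum_const_in_hull)
  qed
  then show ?case
    using r s by (intro exI[of _ "r \<circ> s"]) (auto simp: strict_mono_def)
qed

lemma int_scale_minus_left: "int_scale (- k) x = - int_scale k x"
  using int_scale_add_left[of k "- k" x] by (simp add: eq_neg_iff_add_eq_0 add.commute)

lemma int_scale_diff_left: "int_scale (k - l) x = int_scale k x - int_scale l x"
  using int_scale_add_left[of k "- l" x] by (simp add: int_scale_minus_left)

lemma int_scale_minus_right: "int_scale k (- x) = - int_scale k x"
  by (simp add: int_scale_def sum_negf)

text \<open>The zero vector and the unit vectors yield the base elements, and the combinations are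
  closed under differences because \<open>int_scale\<close> is additive in its integer
  argument.\<close>

lemma group_closure_int_combination:
  assumes "z \<in> group_closure (g ` {..<n})"
  shows "\<exists>x \<in> int_vectors n. (\<Sum>i<n. int_scale (x i) (g i)) = z"
  using assms
proof (induction rule: group_closure.induct)
  case (base s)
  then consider "s = 0" | j where "j < n" "s = g j" by blast
  then show ?case
  proof cases
    case 1
    then show ?thesis
      by (intro bexI[of _ "\<lambda>_. 0"]) (auto simp: int_vectors_def)
  next
    case 2
    have "(\<Sum>i<n. int_scale (if i = j then 1 else 0) (g i)) = (\<Sum>i<n. if i = j then g i else 0)"
      by (rule sum.cong) auto
    with 2 show ?thesis
      by (intro bexI[of _ "\<lambda>i. if i = j then 1 else 0"]) (auto simp: int_vectors_def)
  qed
next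
  case (diff s t)
  then obtain x y where "x \<in> int_vectors n" "y \<in> int_vectors n"
    "(\<Sum>i<n. int_scale (x i) (g i)) = s" "(\<Sum>i<n. int_scale (y i) (g i)) = t" by blast
  then show ?case
    by (intro bexI[of _ "x - y"]) (auto simp: int_vectors_def int_scale_diff_left sum_subtractf)
qed

theorem corollary5p6:
  assumes "finitely_presented TYPE('a::ordered_ab_group_add)"
    and "unperforated TYPE('a)"
  shows "archimedean_group TYPE('a)"
  unfolding archimedean_group_def
proof (intro allI impI)
  fix a b :: 'a
  assume le: "\<forall>n::int. n \<ge> 0 \<longrightarrow> int_scale n a \<le> b"
  obtain n and g :: "nat \<Rightarrow> 'a" and B where gen: "group_closure (g ` {..<n}) = UNIV"
    and "finite B"
    and P: "{x \<in> int_vectors n. (\<Sum>i<n. int_scale (x i) (g i)) \<ge> 0} = is_submonoid hull B"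
    using assms(1) unfolding finitely_presented_def finitely_generated_submonoid_def by blast
  define \<phi> where "\<phi> x = (\<Sum>i<n. int_scale (x i) (g i))" for x
  have "\<forall>m::nat. \<exists>x. x \<in> int_vectors n \<and> \<phi> x = b - int_scale (int m) a"
    using group_closure_int_combination[of _ g n] gen by (auto simp: \<phi>_def)
  then obtain x where x: "\<And>m. x m \<in> int_vectors n" "\<And>m::nat. \<phi> (x m) = b - int_scale (int m) a"
    unfolding choice_iff by blast
  \<comment> \<open>The vector \<open>x m\<close> lies in the cone since its image
    \<open>b - int_scale (int m) a\<close> is nonnegative by \<open>le\<close>.\<close>
  then have "x m \<in> is_submonoid hull B" for m
    using le by (simp flip: P \<phi>_def)
  then obtain r :: "nat \<Rightarrow> nat" where r: "strict_mono r"
    and diff: "\<And>m k. m \<le> k \<Longrightarrow> x (r k) - x (r m) \<in> is_submonoid hull B"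
    using submonoid_hull_dickson[OF \<open>finite B\<close>] by blast
  \<comment> \<open>A single pair suffices: \<open>p = r 0\<close> and
    \<open>q = r 1\<close>.\<close>
  obtain p q where "p < q" and pq: "x q - x p \<in> is_submonoid hull B"
    using diff[of 0 1] strict_monoD[OF r, of 0 1] by auto
  have "0 \<le> \<phi> (x q - x p)"
    using pq by (simp flip: P \<phi>_def)
  also have "\<phi> (x q - x p) = \<phi> (x q) - \<phi> (x p)"
    by (simp add: \<phi>_def int_scale_diff_left sum_subtractf)
  \<comment> \<open>The bound \<open>b\<close> cancels, leaving a multiple of \<open>- a\<close>
    whose factor is positive, as unperforatedness requires.\<close>
  also have "\<dots> = int_scale (int q - int p) (- a)"
    by (simp add: x int_scale_diff_left int_scale_minus_right)
  finally have "0 \<le> - a"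
    using assms(2) \<open>p < q\<close> unfolding unperforated_def
    by (elim allE[of _ "int q - int p"]) auto
  then show "a \<le> 0"
    by simp
qed

end
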